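(* Let $\Bbbk$ be a field, let $G$ be a group, let $X$ be a left $G$-set, and let $q\colon\Bbbk X\twoheadrightarrow V$ be a quotient (surjective homomorphism) of left $\Bbbk G$-modules. Suppose that $q(x)\neq0$ for some $x\in X$ whose orbit $Gx$ is an amenable $G$-set. Then $V$ is an amenable $\Bbbk G$-module. In particular, if $G$ is amenable, then every nonzero left $\Bbbk G$-module is amenable.
   Context: $\Bbbk X$ denotes the $\Bbbk$-vector space with basis $X$, with the linearly extended $G$-action. A left $G$-set $Y$ is amenable if for every finite $S\subseteq G$ and every $\epsilon>0$ there is a finite subset $A\subseteq Y$ with $\#(A\cup SA)<(1+\epsilon)\#A$, where $SA=\{sa:s\in S,a\in A\}$. The group $G$ is amenable if $G$, with the left translation action, is an amenable $G$-set. A left $\Bbbk G$-module $V$ is amenable if for every finite-dimensional subspace $F\le\Bbbk G$ and every $\epsilon>0$ there exists a finite-dimensional subspace $E\le V$ with $\dim\frac{E+FE}{E}<\epsilon\dim E$, where $FE$ is the linear span of $\{fe:f\in F,e\in E\}$ (the strict inequality forces $E\neq 0$). *)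

theory Defs
  imports Complex_Main "HOL-Library.Poly_Mapping"
begin

text \<open>
  Groups are types of class \<^class>\<open>group_add\<close> (not assumed commutative), so the group operation is
  written \<open>+\<close> and the neutral element \<open>0\<close>. With this convention the type \<open>'g \<Rightarrow>\<^sub>0 'k\<close> of finitely
  supported functions, with its convolution product, is the group ring of \<open>'g\<close> over \<open>'k\<close>: the
  basis element \<open>g\<close> is \<open>single g 1\<close>, and \<open>single g a * single h b = single (g + h) (a * b)\<close>.
\<close>

type_synonym ('g, 'k) group_ring = "'g \<Rightarrow>\<^sub>0 'k"

locale G_set =
  fixes act :: "'g::group_add \<Rightarrow> 'x \<Rightarrow> 'x"
    and Y :: "'x set"
  assumes act_closed: "y \<in> Y \<Longrightarrow> act g y \<in> Y"
    and act_zero: "y \<in> Y \<Longrightarrow> act 0 y = y"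
    and act_add: "y \<in> Y \<Longrightarrow> act (g + h) y = act g (act h y)"

definition orbit :: "('g \<Rightarrow> 'x \<Rightarrow> 'x) \<Rightarrow> 'x \<Rightarrow> 'x set"
  where "orbit act x = {act g x | g. True}"

definition amenable_G_set :: "('g::group_add \<Rightarrow> 'x \<Rightarrow> 'x) \<Rightarrow> 'x set \<Rightarrow> bool"
  where "amenable_G_set act Y \<longleftrightarrow> G_set act Y \<and>
    (\<forall>S::'g set. \<forall>\<epsilon>::real. finite S \<longrightarrow> \<epsilon> > 0 \<longrightarrow>
      (\<exists>A. finite A \<and> A \<subseteq> Y \<and>
        real (card (A \<union> {act s a | s a. s \<in> S \<and> a \<in> A})) < (1 + \<epsilon>) * real (card A)))"

definition amenable_group :: "'g::group_add itself \<Rightarrow> bool"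
  where "amenable_group TYPE('g) \<longleftrightarrow> amenable_G_set ((+) :: 'g \<Rightarrow> 'g \<Rightarrow> 'g) UNIV"

text \<open>The library locale \<^locale>\<open>module\<close> is restricted to commutative rings of scalars.\<close>

locale left_module =
  fixes smult :: "'r::ring_1 \<Rightarrow> 'v::ab_group_add \<Rightarrow> 'v"
  assumes smult_right_distrib: "smult a (x + y) = smult a x + smult a y"
    and smult_left_distrib: "smult (a + b) x = smult a x + smult b x"
    and smult_assoc: "smult (a * b) x = smult a (smult b x)"
    and smult_one: "smult 1 x = x"

locale left_module_hom =
  source: left_module smult1 + target: left_module smult2
  for smult1 :: "'r::ring_1 \<Rightarrow> 'v::ab_group_add \<Rightarrow> 'v"
    and smult2 :: "'r \<Rightarrow> 'w::ab_group_add \<Rightarrow> 'w" +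
  fixes f :: "'v \<Rightarrow> 'w"
  assumes hom_add: "f (x + y) = f x + f y"
    and hom_smult: "f (smult1 a x) = smult2 a (f x)"

text \<open>
  The vector space with basis \<open>'x\<close> is the type \<open>'x \<Rightarrow>\<^sub>0 'k\<close>, with basis vectors \<open>single x 1\<close>; the
  action of a group on \<open>'x\<close> extends linearly to an action of the group ring.
\<close>

definition perm_smult ::
    "('g \<Rightarrow> 'x \<Rightarrow> 'x) \<Rightarrow> ('g, 'k::field) group_ring \<Rightarrow> ('x \<Rightarrow>\<^sub>0 'k) \<Rightarrow> ('x \<Rightarrow>\<^sub>0 'k)"
  where "perm_smult act f v =
    (\<Sum>g\<in>Poly_Mapping.keys f. \<Sum>x\<in>Poly_Mapping.keys v.
      Poly_Mapping.single (act g x) (Poly_Mapping.lookup f g * Poly_Mapping.lookup v x))"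

text \<open>The underlying vector space of a module over the group ring, by restriction of scalars.\<close>

definition scalar_mult ::
    "(('g::group_add, 'k::field) group_ring \<Rightarrow> 'v \<Rightarrow> 'v) \<Rightarrow> 'k \<Rightarrow> 'v \<Rightarrow> 'v"
  where "scalar_mult smult c v = smult (Poly_Mapping.single 0 c) v"

definition fin_dim_subspace :: "('k::field \<Rightarrow> 'v::ab_group_add \<Rightarrow> 'v) \<Rightarrow> 'v set \<Rightarrow> bool"
  where "fin_dim_subspace scale E \<longleftrightarrow>
    module.subspace scale E \<and> (\<exists>B. finite B \<and> module.span scale B = E)"

text \<open>
  A basis of the quotient \<open>W/E\<close>, given by representatives in \<open>W\<close>: a linear combination of the cosets
  of elements of \<open>B\<close> vanishes in \<open>W/E\<close> iff the same combination of the representatives lies in \<open>E\<close>.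
  Independence forces distinct elements of \<open>B\<close> to have distinct cosets, so \<open>card B\<close> is the number of
  elements of the basis. As for \<^const>\<open>vector_space.dim\<close>, infinite dimension yields the value \<open>0\<close>.
\<close>

definition quotient_basis ::
    "('k::field \<Rightarrow> 'v::ab_group_add \<Rightarrow> 'v) \<Rightarrow> 'v set \<Rightarrow> 'v set \<Rightarrow> 'v set \<Rightarrow> bool"
  where "quotient_basis scale W E B \<longleftrightarrow> B \<subseteq> W \<and>
    (\<forall>T u. finite T \<and> T \<subseteq> B \<and> (\<Sum>v\<in>T. scale (u v) v) \<in> E \<longrightarrow> (\<forall>v\<in>T. u v = 0)) \<and>
    (\<forall>w\<in>W. \<exists>T u. finite T \<and> T \<subseteq> B \<and> w - (\<Sum>v\<in>T. scale (u v) v) \<in> E)"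

definition quotient_dim ::
    "('k::field \<Rightarrow> 'v::ab_group_add \<Rightarrow> 'v) \<Rightarrow> 'v set \<Rightarrow> 'v set \<Rightarrow> nat"
  where "quotient_dim scale W E = card (SOME B. quotient_basis scale W E B)"

definition product_span ::
    "(('g::group_add, 'k::field) group_ring \<Rightarrow> 'v::ab_group_add \<Rightarrow> 'v) \<Rightarrow>
      ('g, 'k) group_ring set \<Rightarrow> 'v set \<Rightarrow> 'v set"
  where "product_span smult F E =
    module.span (scalar_mult smult) {smult f e | f e. f \<in> F \<and> e \<in> E}"

definition amenable_module ::
    "(('g::group_add, 'k::field) group_ring \<Rightarrow> 'v::ab_group_add \<Rightarrow> 'v) \<Rightarrow> bool"
  where "amenable_module smult \<longleftrightarrow> left_module smult \<and>
    (\<forall>F::('g, 'k) group_ring set. \<forall>\<epsilon>::real.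
      fin_dim_subspace (scalar_mult (*)) F \<longrightarrow> \<epsilon> > 0 \<longrightarrow>
      (\<exists>E. fin_dim_subspace (scalar_mult smult) E \<and>
        real (quotient_dim (scalar_mult smult) {e + y | e y. e \<in> E \<and> y \<in> product_span smult F E} E)
          < \<epsilon> * real (vector_space.dim (scalar_mult smult) E)))"

lemma left_module_group_ring:
  "left_module ((*) :: ('g::group_add, 'k::field) group_ring \<Rightarrow> _)"
  by unfold_locales (simp_all add: algebra_simps)

lemma vector_space_scalar_mult:
  assumes "left_module smult"
  shows "vector_space (scalar_mult smult)"
proof -
  interpret left_module smult by fact
  show ?thesis
    by unfold_locales
      (auto simp: scalar_mult_def smult_right_distrib smult_left_distrib smult_one single_add
        simp flip: smult_assoc simp: mult_single)
qed

lemma perm_smult_superset: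
  assumes "finite M" "Poly_Mapping.keys f \<subseteq> M" "finite N" "Poly_Mapping.keys v \<subseteq> N"
  shows "perm_smult act f v = (\<Sum>g\<in>M. \<Sum>x\<in>N.
    Poly_Mapping.single (act g x) (Poly_Mapping.lookup f g * Poly_Mapping.lookup v x))"
  unfolding perm_smult_def using assms
  by (intro sum.mono_neutral_cong_left) 
    (auto simp: in_keys_iff intro!: sum.mono_neutral_left)

lemma perm_smult_single:
  "perm_smult act (Poly_Mapping.single g a) (Poly_Mapping.single x b) =
    Poly_Mapping.single (act g x) (a * b)"
  by (subst perm_smult_superset[of "{g}" _ "{x}"]) (auto simp: lookup_single)

lemma perm_smult_add_right: "perm_smult act f (v + w) = perm_smult act f v + perm_smult act f w"
proof -
  let ?M = "Poly_Mapping.keys f" and ?N = "Poly_Mapping.keys v \<union> Poly_Mapping.keys w"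
  have "Poly_Mapping.keys (v + w) \<subseteq> ?N"
    by (rule Poly_Mapping.keys_add)
  then show ?thesis
    by (simp add: perm_smult_superset[of ?M _ ?N] lookup_add algebra_simps single_add sum.distrib)
qed

lemma perm_smult_add_left: "perm_smult act (f + f') v = perm_smult act f v + perm_smult act f' v"
proof -
  let ?M = "Poly_Mapping.keys f \<union> Poly_Mapping.keys f'" and ?N = "Poly_Mapping.keys v"
  have "Poly_Mapping.keys (f + f') \<subseteq> ?M"
    by (rule Poly_Mapping.keys_add)
  then show ?thesis
    by (simp add: perm_smult_superset[of ?M _ ?N] lookup_add algebra_simps single_add sum.distrib)
qed

lemma poly_mapping_single_induct:
  fixes f :: "'a \<Rightarrow>\<^sub>0 'b::comm_monoid_add"
  assumes "\<And>a c. P (Poly_Mapping.single a c)" "\<And>f g. P f \<Longrightarrow> P g \<Longrightarrow> P (f + g)"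
  shows "P f"
proof -
  have "P (\<Sum>a\<in>A. Poly_Mapping.single a (Poly_Mapping.lookup f a))" if "finite A" for A
    using that
  proof induction
    case empty
    then show ?case using assms(1)[of undefined 0] by simp
  qed (use assms in simp)
  moreover have "(\<Sum>a\<in>Poly_Mapping.keys f. Poly_Mapping.single a (Poly_Mapping.lookup f a)) = f"
    by (rule poly_mapping_eqI) (auto simp: lookup_sum lookup_single when_def in_keys_iff)
  ultimately show ?thesis
    by (metis finite_keys)
qed

lemma left_module_perm_smult:
  fixes act :: "'g::group_add \<Rightarrow> 'x \<Rightarrow> 'x"
  assumes "G_set act UNIV"
  shows "left_module (perm_smult act :: ('g, 'k::field) group_ring \<Rightarrow> _)"
proof -
  interpret G_set act UNIV by fact
  note add = perm_smult_add_left perm_smult_add_right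
  have one: "perm_smult act 1 v = v" for v :: "'x \<Rightarrow>\<^sub>0 'k"
    by (induction v rule: poly_mapping_single_induct)
      (simp_all add: add perm_smult_single act_zero flip: single_one)
  have "perm_smult act (Poly_Mapping.single g a * Poly_Mapping.single h b) v =
      perm_smult act (Poly_Mapping.single g a) (perm_smult act (Poly_Mapping.single h b) v)"
    for g h a b and v :: "'x \<Rightarrow>\<^sub>0 'k"
    by (induction v rule: poly_mapping_single_induct)
      (simp_all add: add perm_smult_single mult_single act_add mult.assoc)
  then have "perm_smult act (Poly_Mapping.single g a * f) v =
      perm_smult act (Poly_Mapping.single g a) (perm_smult act f v)"
    for g a f and v :: "'x \<Rightarrow>\<^sub>0 'k"
    by (induction f rule: poly_mapping_single_induct) (simp_all add: add distrib_left)
  then have "perm_smult act (e * f) v = perm_smult act e (perm_smult act f v)"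
    for e f and v :: "'x \<Rightarrow>\<^sub>0 'k"
    by (induction e rule: poly_mapping_single_induct) (simp_all add: add distrib_right)
  with one show ?thesis
    by unfold_locales (simp_all add: add)
qed

end

theory Submission
  imports Defs
begin

text \<open>
  Let \<open>r B\<close> be the dimension of the span of the image in \<open>V\<close> of a finite subset \<open>B\<close> of the orbit
  \<open>Y\<close>; it is a \<open>G\<close>-invariant submodular function, and \<open>r\<close> is positive on nonempty sets. The image of
  a Foelner set \<open>A\<close> need not span an almost invariant subspace, because \<open>r A\<close> may be much smaller
  than \<open>card A\<close>. Instead, decompose \<open>A\<close> into layers: for \<open>t > 0\<close> let \<open>B\<^sub>t \<subseteq> A\<close> maximize
  \<open>card B - t * r B\<close>. The maximum is a convex function of \<open>t\<close> with derivative \<open>- r B\<^sub>t\<close>, it is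
  \<open>card A\<close> at \<open>0\<close> and vanishes for large \<open>t\<close>, so the integral of \<open>r B\<^sub>t\<close> is \<open>card A\<close>. By
  submodularity the largest maximizers grow with \<open>A\<close>, so invariance gives \<open>B\<^sub>t \<union> S B\<^sub>t \<subseteq> B'\<^sub>t\<close>
  for the layers \<open>B'\<^sub>t\<close> of \<open>A \<union> S A\<close>. As \<open>card (A \<union> S A) < (1 + \<epsilon>) * card A\<close>, some layer
  satisfies \<open>r (B\<^sub>t \<union> S B\<^sub>t) < (1 + \<epsilon>) * r B\<^sub>t\<close>. The proof uses the values \<open>t = j / n\<close>.
\<close>

section \<open>Layers of a submodular rank function\<close>

text \<open>These are the properties of a loopless matroid rank function, required on finite subsets
  of \<open>Y\<close>. The instance used below is the dimension of the span of a family of nonzero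
  vectors indexed by \<open>Y\<close>.\<close>

locale submodular_rank =
  fixes Y :: "'a set" and r :: "'a set \<Rightarrow> nat"
  assumes rank_empty: "r {} = 0"
    and rank_singleton: "y \<in> Y \<Longrightarrow> r {y} = 1"
    and rank_mono: "A \<subseteq> B \<Longrightarrow> B \<subseteq> Y \<Longrightarrow> finite B \<Longrightarrow> r A \<le> r B"
    and rank_submodular: "A \<subseteq> Y \<Longrightarrow> B \<subseteq> Y \<Longrightarrow> finite A \<Longrightarrow> finite B \<Longrightarrow>
      r (A \<union> B) + r (A \<inter> B) \<le> r A + r B"
begin

text \<open>This is \<open>n\<close> times the functional \<open>card B - t * r B\<close> at
  \<open>t = j / n\<close>, scaled so that all values are integers.\<close>

definition excess :: "nat \<Rightarrow> nat \<Rightarrow> 'a set \<Rightarrow> int"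
  where "excess n j B = int n * int (card B) - int j * int (r B)"

text \<open>A relation rather than a function, since a maximizer need not be unique.\<close>

definition layer :: "nat \<Rightarrow> nat \<Rightarrow> 'a set \<Rightarrow> 'a set \<Rightarrow> bool"
  where "layer n j A B \<longleftrightarrow> B \<subseteq> A \<and> (\<forall>C\<subseteq>A. excess n j C \<le> excess n j B)"

lemma layer_subset: "layer n j A B \<Longrightarrow> B \<subseteq> A"
  by (simp add: layer_def)

lemma layer_excess: "layer n j A B \<Longrightarrow> C \<subseteq> A \<Longrightarrow> excess n j C \<le> excess n j B"
  by (simp add: layer_def)

lemma rank_le_card:
  assumes "finite A" "A \<subseteq> Y"
  shows "r A \<le> card A"
  using assms
proof (induction A)
  case empty
  then show ?case by (simp add: rank_empty)
next
  case (insert a A)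
  then show ?case
    using rank_submodular[of "{a}" A] rank_singleton[of a] by auto
qed

lemma rank_pos:
  assumes "finite A" "A \<subseteq> Y" "A \<noteq> {}"
  shows "1 \<le> r A"
proof -
  obtain a where "a \<in> A"
    using assms(3) by blast
  then show ?thesis
    using rank_mono[of "{a}" A] rank_singleton[of a] assms by auto
qed

text \<open>Uncrossing: \<open>card\<close> is modular and \<open>r\<close> submodular, so
  \<open>excess n j\<close> is supermodular. The intersection \<open>B \<inter> B'\<close> is a
  competitor of \<open>B\<close> inside \<open>A\<close>, hence its excess is at most that of
  \<open>B\<close>, and the union must do at least as well as \<open>B'\<close>.\<close>

lemma layer_Un:
  assumes "finite A'" "A' \<subseteq> Y" "A \<subseteq> A'" "layer n j A B" "layer n j A' B'"
  shows "layer n j A' (B \<union> B')"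
proof -
  have B: "B \<subseteq> A" "B' \<subseteq> A'"
    using assms layer_subset by blast+
  then have "B \<subseteq> A'"
    using assms(3) by blast
  with B have fin: "finite B" "finite B'" and sub: "B \<subseteq> Y" "B' \<subseteq> Y"
    using assms(1,2) by (auto intro: rev_finite_subset)
  have "int (r (B \<union> B')) + int (r (B \<inter> B')) \<le> int (r B) + int (r B')"
    using rank_submodular[OF sub fin] by linarith
  then have "int j * (int (r (B \<union> B')) + int (r (B \<inter> B'))) \<le> int j * (int (r B) + int (r B'))"
    by (rule mult_left_mono) simp
  moreover have "int (card (B \<union> B')) + int (card (B \<inter> B')) = int (card B) + int (card B')"
    using card_Un_Int[OF fin] by linarith
  then have "int n * (int (card (B \<union> B')) + int (card (B \<inter> B'))) =
      int n * (int (card B) + int (card B'))"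
    by (rule arg_cong)
  ultimately have "excess n j B + excess n j B' \<le> excess n j (B \<union> B') + excess n j (B \<inter> B')"
    by (simp add: excess_def algebra_simps)
  moreover have "excess n j (B \<inter> B') \<le> excess n j B"
    using layer_excess[OF assms(4)] B by blast
  ultimately have "excess n j B' \<le> excess n j (B \<union> B')"
    by linarith
  then have "excess n j C \<le> excess n j (B \<union> B')" if "C \<subseteq> A'" for C
    using layer_excess[OF assms(5) that] by linarith
  with B assms(3) show ?thesis
    by (auto simp: layer_def)
qed

lemma largest_layer_exists:
  assumes "finite A" "A \<subseteq> Y"
  obtains B where "layer n j A B" "\<And>C D. C \<subseteq> A \<Longrightarrow> layer n j C D \<Longrightarrow> D \<subseteq> B"
proof -
  have "finite (excess n j ` Pow A)"
    using assms by simp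
  then have "Max (excess n j ` Pow A) \<in> excess n j ` Pow A"
    by (rule Max_in) auto
  then obtain B0 where B0: "B0 \<subseteq> A" "excess n j B0 = Max (excess n j ` Pow A)"
    by auto
  have "layer n j A B0"
    unfolding layer_def using B0 assms by (auto intro!: Max_ge)
  moreover have "finite {B. layer n j A B}"
    by (rule finite_subset[of _ "Pow A"]) (use assms in \<open>auto dest: layer_subset\<close>)
  ultimately obtain B where B: "layer n j A B" "\<And>B'. layer n j A B' \<Longrightarrow> B \<subseteq> B' \<Longrightarrow> B = B'"
    using finite_has_maximal[of "{B. layer n j A B}"] by auto
  \<comment> \<open>By uncrossing, \<open>D \<union> B\<close> is again a layer of \<open>A\<close>,
    so maximality of \<open>B\<close> under inclusion absorbs \<open>D\<close>.\<close>
  have "D \<subseteq> B" if "C \<subseteq> A" "layer n j C D" for C D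
    using B(2)[OF layer_Un[OF assms that B(1)]] by auto
  with B(1) show ?thesis
    by (rule that)
qed

text \<open>Discrete form of the derivative of the maximal excess: each of the two maximizers is
  tested as a competitor in the problem that the other one solves.\<close>

lemma layer_excess_diff:
  assumes "layer n j A B" "layer n (Suc j) A B'"
  shows "int (r B') \<le> excess n j B - excess n (Suc j) B'"
    and "excess n j B - excess n (Suc j) B' \<le> int (r B)"
proof -
  have suc: "excess n (Suc j) C = excess n j C - int (r C)" for C
    by (simp add: excess_def algebra_simps)
  show "int (r B') \<le> excess n j B - excess n (Suc j) B'"
    using layer_excess[OF assms(1) layer_subset[OF assms(2)]] suc[of B'] by linarith
  show "excess n j B - excess n (Suc j) B' \<le> int (r B)"
    using layer_excess[OF assms(2) layer_subset[OF assms(1)]] suc[of B] by linarith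
qed

text \<open>Riemann sums for the integral of the layer ranks. Summing the one-step drops of the
  maximal excess telescopes from its value at \<open>0\<close> down to its value at
  \<open>N\<close>.\<close>

lemma layers_rank_sum:
  assumes "finite A" "A \<subseteq> Y" "n * card A \<le> N" "\<And>j. layer n j A (B j)"
  shows "(\<Sum>j<N. r (B (Suc j))) \<le> n * card A"
    and "n * card A \<le> (\<Sum>j<N. r (B (Suc j))) + card A"
proof -
  let ?e = "\<lambda>j. excess n j (B j)"
  have sub: "B j \<subseteq> A" for j
    using assms(4) layer_subset by blast
  have telescope: "(\<Sum>j<N. ?e j - ?e (Suc j)) = ?e 0 - ?e N"
    by (rule sum_lessThan_telescope')
  \<comment> \<open>At \<open>j = 0\<close> the rank term vanishes, so the whole of \<open>A\<close>
    attains the maximum.\<close>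
  have e0: "?e 0 = int (n * card A)"
    using layer_excess[OF assms(4), of A 0] mult_le_mono2[OF card_mono[OF assms(1) sub, of 0], of n]
    by (cases "n = 0") (simp_all add: excess_def flip: of_nat_mult)
  \<comment> \<open>A nonempty set has rank at least 1, so for \<open>j = N \<ge> n * card A\<close>
    its excess is at most 0, the excess of the empty set.\<close>
  have eN: "?e N = 0"
  proof (rule antisym)
    show "0 \<le> ?e N"
      using layer_excess[OF assms(4), of "{}" N] by (simp add: excess_def rank_empty)
    show "?e N \<le> 0"
    proof (cases "B N = {}")
      case False
      then have "1 \<le> r (B N)"
        using sub[of N] assms(1,2) by (intro rank_pos) (auto intro: finite_subset[of _ A])
      have "n * card (B N) \<le> n * card A"
        using card_mono[OF assms(1) sub] by simp
      also have "\<dots> \<le> N * 1"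
        using assms(3) by simp
      also have "\<dots> \<le> N * r (B N)"
        using \<open>1 \<le> r (B N)\<close> by (rule mult_le_mono2)
      finally have "n * card (B N) \<le> N * r (B N)" .
      then show ?thesis
        by (simp add: excess_def flip: of_nat_mult)
    qed (simp add: excess_def rank_empty)
  qed
  have "(\<Sum>j<N. int (r (B (Suc j)))) \<le> (\<Sum>j<N. ?e j - ?e (Suc j))"
    by (intro sum_mono layer_excess_diff[OF assms(4,4)])
  then have "int (\<Sum>j<N. r (B (Suc j))) \<le> int (n * card A)"
    using telescope e0 eN by simp
  then show "(\<Sum>j<N. r (B (Suc j))) \<le> n * card A"
    by linarith
  have "(\<Sum>j<N. ?e j - ?e (Suc j)) \<le> (\<Sum>j<N. int (r (B j)))"
    by (intro sum_mono layer_excess_diff[OF assms(4,4)])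
  then have "int (n * card A) \<le> int (\<Sum>j<N. r (B j))"
    using telescope e0 eN by simp
  then have lower: "n * card A \<le> (\<Sum>j<N. r (B j))"
    by linarith
  \<comment> \<open>Passing to the indices \<open>Suc j\<close> costs at most the term
    \<open>r (B 0)\<close>, which produces the error \<open>card A\<close>.\<close>
  have "(\<Sum>j<N. r (B j)) \<le> (\<Sum>j<Suc N. r (B j))"
    by simp
  also have "\<dots> = r (B 0) + (\<Sum>j<N. r (B (Suc j)))"
    by (rule sum.lessThan_Suc_shift)
  also have "r (B 0) \<le> card A"
    using rank_mono[OF sub[of 0] assms(2,1)] rank_le_card[OF assms(1,2)] by linarith
  finally show "n * card A \<le> (\<Sum>j<N. r (B (Suc j))) + card A"
    using lower by linarith
qed

text \<open>Transfers the Foelner condition from cardinality to an invariant rank. The rank sums of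
  the layers recover cardinalities up to a small error, so almost invariance in cardinality forces
  it in rank for at least one layer.\<close>

lemma amenable_G_set_rank:
  fixes act :: "'g::group_add \<Rightarrow> 'a \<Rightarrow> 'a" and \<epsilon> :: real
  assumes amenable: "amenable_G_set act Y"
    and inv: "\<And>g A. finite A \<Longrightarrow> A \<subseteq> Y \<Longrightarrow> r (act g ` A) = r A"
    and S: "finite S" and eps: "\<epsilon> > 0"
  obtains B where "finite B" "B \<subseteq> Y"
    "real (r (B \<union> {act s b | s b. s \<in> S \<and> b \<in> B})) < (1 + \<epsilon>) * real (r B)"
proof -
  interpret G_set act Y
    using amenable by (simp add: amenable_G_set_def)
  have inj: "inj_on (act g) Y" for g
  proof (rule inj_on_inverseI)
    show "act (- g) (act g y) = y" if "y \<in> Y" for y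
      using act_add[OF that, of "- g" g] act_zero[OF that] by simp
  qed
  \<comment> \<open>Half of the tolerance goes to the Foelner set; the other half pays for the
    discretization error in \<open>layers_rank_sum\<close>.\<close>
  obtain A where A: "finite A" "A \<subseteq> Y" and card_A:
    "real (card (A \<union> {act s a | s a. s \<in> S \<and> a \<in> A})) < (1 + \<epsilon> / 2) * real (card A)"
    using amenable[unfolded amenable_G_set_def, THEN conjunct2, rule_format, OF S half_gt_zero[OF eps]]
    by blast
  define A' where "A' = A \<union> {act s a | s a. s \<in> S \<and> a \<in> A}"
  have "{act s a | s a. s \<in> S \<and> a \<in> A} = (\<Union>s\<in>S. act s ` A)"
    by auto
  then have A': "finite A'" "A' \<subseteq> Y" "A \<subseteq> A'"
    using A S act_closed by (auto simp: A'_def)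
  \<comment> \<open>The bound on \<open>n\<close> is equivalent to
    \<open>(1 + \<epsilon> / 2) * n \<le> (1 + \<epsilon>) * (n - 1)\<close>, the comparison needed
    at the end.\<close>
  obtain n :: nat where n: "real n \<ge> 2 * (1 + \<epsilon>) / \<epsilon>"
    using real_arch_simple by blast
  define N where "N = n * card A'"
  have "n * card A \<le> N"
    unfolding N_def using card_mono[OF A'(1,3)] by simp
  have "\<exists>B. layer n j A B" for j
    using largest_layer_exists[OF A] by metis
  then obtain B where B: "\<And>j. layer n j A (B j)"
    by metis
  \<comment> \<open>The layers of \<open>A\<close> may be arbitrary, but those of \<open>A'\<close>
    are taken largest, so that they contain every layer of every subset of
    \<open>A'\<close>.\<close>
  have "\<exists>B'. layer n j A' B' \<and> (\<forall>C D. C \<subseteq> A' \<longrightarrow> layer n j C D \<longrightarrow> D \<subseteq> B')" for j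
    using largest_layer_exists[OF A'(1,2)] by metis
  then obtain B' where B': "\<And>j. layer n j A' (B' j)"
    and largest: "\<And>j C D. C \<subseteq> A' \<Longrightarrow> layer n j C D \<Longrightarrow> D \<subseteq> B' j"
    by metis
  have excess_act: "excess n j (act g ` C) = excess n j C" if "C \<subseteq> A" for g j C
  proof -
    have "finite C" "C \<subseteq> Y"
      using that A by (auto intro: finite_subset)
    then show ?thesis
      using inj_on_subset[OF inj] by (simp add: excess_def inv card_image)
  qed
  have layer_act: "layer n j (act g ` A) (act g ` B j)" for g j
    unfolding layer_def
  proof (intro conjI allI impI)
    show "act g ` B j \<subseteq> act g ` A"
      by (intro image_mono layer_subset[OF B])
    show "excess n j D \<le> excess n j (act g ` B j)" if "D \<subseteq> act g ` A" for D
    proof -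
      from that obtain C where "C \<subseteq> A" "D = act g ` C"
        by (rule subset_imageE)
      then show ?thesis
        using layer_excess[OF B] excess_act layer_subset[OF B] by simp
    qed
  qed
  \<comment> \<open>The translate of a layer of \<open>A\<close> is a layer of the translate of
    \<open>A\<close>, which is a subset of \<open>A'\<close>.\<close>
  have "act s ` B j \<subseteq> B' j" if "s \<in> S" for s j
  proof (rule largest[OF _ layer_act])
    show "act s ` A \<subseteq> A'"
      using that by (auto simp: A'_def)
  qed
  moreover have "B j \<subseteq> B' j" for j
    by (rule largest[OF A'(3) B])
  ultimately have sub: "B j \<union> {act s b | s b. s \<in> S \<and> b \<in> B j} \<subseteq> B' j" for j
    by blast
  have "(1 + \<epsilon> / 2) * real n \<le> (1 + \<epsilon>) * (real n - 1)"
    using n eps by (simp add: field_simps)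
  \<comment> \<open>If every index failed, summing over \<open>j < N\<close> would bound
    \<open>n * card A'\<close> below by \<open>(1 + \<epsilon>) * (n - 1) * card A\<close>, against
    the choice of \<open>A\<close> and \<open>n\<close>.\<close>
  have "\<exists>j. real (r (B' (Suc j))) < (1 + \<epsilon>) * real (r (B (Suc j)))"
  proof (rule ccontr)
    assume "\<not> ?thesis"
    then have "(\<Sum>j<N. (1 + \<epsilon>) * real (r (B (Suc j)))) \<le> (\<Sum>j<N. real (r (B' (Suc j))))"
      by (intro sum_mono) (simp add: not_less)
    also have "\<dots> = real (\<Sum>j<N. r (B' (Suc j)))"
      by simp
    also have "\<dots> \<le> real (n * card A')"
      using layers_rank_sum(1)[OF A'(1,2) _ B'] N_def by (metis of_nat_mono order_refl)
    also have "\<dots> = real n * real (card A')"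
      by simp
    also have "\<dots> < real n * ((1 + \<epsilon> / 2) * real (card A))"
    proof (rule mult_strict_left_mono)
      have "0 < 2 * (1 + \<epsilon>) / \<epsilon>"
        using eps by simp
      with n show "0 < real n"
        by linarith
    qed (use card_A in \<open>simp add: A'_def\<close>)
    also have "\<dots> = ((1 + \<epsilon> / 2) * real n) * real (card A)"
      by simp
    also have "\<dots> \<le> ((1 + \<epsilon>) * (real n - 1)) * real (card A)"
      by (rule mult_right_mono) (fact, simp)
    also have "\<dots> = (1 + \<epsilon>) * (real (n * card A) - real (card A))"
      by (simp add: algebra_simps)
    also have "\<dots> \<le> (1 + \<epsilon>) * real (\<Sum>j<N. r (B (Suc j)))"
    proof (rule mult_left_mono)
      show "real (n * card A) - real (card A) \<le> real (\<Sum>j<N. r (B (Suc j)))"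
        using layers_rank_sum(2)[OF A \<open>n * card A \<le> N\<close> B] by linarith
    qed (use eps in simp)
    finally show False
      by (simp add: sum_distrib_left)
  qed
  then obtain j where j: "real (r (B' (Suc j))) < (1 + \<epsilon>) * real (r (B (Suc j)))" ..
  have "B' (Suc j) \<subseteq> A'"
    using B' layer_subset by blast
  then have "r (B (Suc j) \<union> {act s b | s b. s \<in> S \<and> b \<in> B (Suc j)}) \<le> r (B' (Suc j))"
    using A'(1,2) by (intro rank_mono sub) (auto intro: finite_subset[of _ A'])
  with j have "real (r (B (Suc j) \<union> {act s b | s b. s \<in> S \<and> b \<in> B (Suc j)}))
      < (1 + \<epsilon>) * real (r (B (Suc j)))"
    by linarith
  moreover have "B (Suc j) \<subseteq> A"
    using B by (rule layer_subset)
  ultimately show ?thesis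
    using finite_subset[OF _ A(1)] subset_trans[OF _ A(2)] that[of "B (Suc j)"] by presburger
qed

end

section \<open>Dimensions\<close>

context vector_space
begin

text \<open>Finiteness of \<open>W\<close> excludes infinite dimension, where \<open>dim\<close>
  takes the default value 0.\<close>

lemma dim_mono_finite:
  assumes "V \<subseteq> span W" "finite W"
  shows "dim V \<le> dim W"
proof -
  obtain B where B: "B \<subseteq> W" "W \<subseteq> span B" "card B = dim W"
    by (rule basis_exists[of W])
  have "V \<subseteq> span B"
    using assms(1) span_minimal[OF B(2) subspace_span] by (rule subset_trans)
  then show ?thesis
    using dim_le_card[of V B] B(3) finite_subset[OF B(1) assms(2)] by simp
qed

text \<open>Extend a basis \<open>I\<close> of \<open>U\<close> to bases \<open>J\<close> of
  \<open>A\<close> and \<open>K\<close> of \<open>B\<close>: then \<open>J \<union> K\<close> spans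
  \<open>A \<union> B\<close>, and \<open>J \<inter> K\<close> contains \<open>I\<close>. The set
  \<open>U\<close> stands for the image of an intersection, which can be smaller than the
  intersection of the images.\<close>

lemma dim_Un_Int_le:
  assumes "finite (A \<union> B)" "U \<subseteq> A" "U \<subseteq> B"
  shows "dim (A \<union> B) + dim U \<le> dim A + dim B"
proof -
  obtain I where I: "I \<subseteq> U" "independent I" "U \<subseteq> span I" "card I = dim U"
    by (rule basis_exists[of U])
  obtain J where J: "I \<subseteq> J" "J \<subseteq> A" "independent J" "A \<subseteq> span J"
    using maximal_independent_subset_extend[of I A] I assms(2) by blast
  obtain K where K: "I \<subseteq> K" "K \<subseteq> B" "independent K" "B \<subseteq> span K"
    using maximal_independent_subset_extend[of I B] I assms(3) by blast
  have card: "card J = dim A" "card K = dim B"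
    using J K basis_card_eq_dim by blast+
  have fin: "finite J" "finite K"
    using J K assms(1) by (auto intro: finite_subset[of J A] finite_subset[of K B])
  have "span J \<subseteq> span (J \<union> K)" "span K \<subseteq> span (J \<union> K)"
    by (simp_all add: span_mono)
  then have "dim (A \<union> B) \<le> card (J \<union> K)"
    using J(4) K(4) fin by (intro dim_le_card) auto
  moreover have "card I \<le> card (J \<inter> K)"
    using J K fin by (intro card_mono) auto
  ultimately show ?thesis
    using card_Un_Int[OF fin] card I(4) by linarith
qed

text \<open>Extend a basis \<open>C\<close> of \<open>E\<close> to a maximal independent subset
  \<open>D\<close> of \<open>W\<close>; the added vectors \<open>D - C\<close> represent a basis of
  the quotient. This makes the choice in \<open>quotient_dim\<close> meaningful.\<close>

lemma quotient_basis_exists: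
  assumes "subspace E" "E \<subseteq> W"
  shows "\<exists>B. quotient_basis scale W E B"
proof -
  obtain C where C: "C \<subseteq> E" "independent C" "E \<subseteq> span C"
    using maximal_independent_subset by blast
  obtain D where D: "C \<subseteq> D" "D \<subseteq> W" "independent D" "W \<subseteq> span D"
    using maximal_independent_subset_extend[of C W] C assms(2) by blast
  have E: "E = span C"
    using C assms(1) by (simp add: span_subspace)
  have indep: "u v = 0"
    if T: "finite T" "T \<subseteq> D - C" and sum: "(\<Sum>w\<in>T. scale (u w) w) \<in> E" and "v \<in> T" for T u v
  proof (rule ccontr)
    assume "u v \<noteq> 0"
    have "C \<subseteq> D - {v}" "T - {v} \<subseteq> D - {v}"
      using D(1) T \<open>v \<in> T\<close> by auto
    then have "(\<Sum>w\<in>T. scale (u w) w) \<in> span (D - {v})"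
      "(\<Sum>w\<in>T-{v}. scale (u w) w) \<in> span (D - {v})"
      using sum E span_mono by (blast, auto intro!: span_sum span_scale intro: span_base)
    then have "(\<Sum>w\<in>T. scale (u w) w) - (\<Sum>w\<in>T-{v}. scale (u w) w) \<in> span (D - {v})"
      by (rule span_diff)
    then have "scale (u v) v \<in> span (D - {v})"
      using T(1) \<open>v \<in> T\<close> by (simp add: sum.remove)
    then have "scale (inverse (u v)) (scale (u v) v) \<in> span (D - {v})"
      by (rule span_scale)
    then have "v \<in> span (D - {v})"
      using \<open>u v \<noteq> 0\<close> by simp
    moreover have "v \<in> D"
      using T \<open>v \<in> T\<close> by auto
    ultimately show False
      using D(3) by (auto simp: dependent_def)
  qed
  have gen: "\<exists>T u. finite T \<and> T \<subseteq> D - C \<and> w - (\<Sum>v\<in>T. scale (u v) v) \<in> E"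
    if "w \<in> W" for w
  proof -
    have "w \<in> span (C \<union> (D - C))"
      using that D by (auto simp: Un_absorb1)
    then obtain x y where w: "w = x + y" "x \<in> span C" "y \<in> span (D - C)"
      unfolding span_Un by blast
    then obtain T u where "finite T" "T \<subseteq> D - C" "y = (\<Sum>v\<in>T. scale (u v) v)"
      unfolding span_explicit by blast
    then show ?thesis
      using w E by (intro exI[of _ T] exI[of _ u]) auto
  qed
  show ?thesis
    unfolding quotient_basis_def
  proof (rule exI[of _ "D - C"], intro conjI allI impI ballI)
    show "D - C \<subseteq> W"
      using D(2) by blast
    show "u v = 0"
      if "finite T \<and> T \<subseteq> D - C \<and> (\<Sum>w\<in>T. scale (u w) w) \<in> E" "v \<in> T" for T u v
      using that indep[of T u v] by simp
  qed (rule gen)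
qed

text \<open>Whichever quotient basis \<open>quotient_dim\<close> selects, together with a basis of
  \<open>E\<close> it forms an independent subset of \<open>span U\<close>.\<close>

lemma quotient_dim_le:
  assumes "finite U" "subspace E" "E \<subseteq> W" "W \<subseteq> span U"
  shows "quotient_dim scale W E + dim E \<le> dim U"
proof -
  define Q where "Q = (SOME B. quotient_basis scale W E B)"
  have "quotient_basis scale W E Q"
    unfolding Q_def using quotient_basis_exists[OF assms(2,3)] by (rule someI_ex)
  note Q_basis = this[unfolded quotient_basis_def]
  have Q: "Q \<subseteq> W"
    using Q_basis by (rule conjunct1)
  have indep: "u v = 0"
    if "finite T" "T \<subseteq> Q" "(\<Sum>v\<in>T. scale (u v) v) \<in> E" "v \<in> T" for T u v
    using Q_basis[THEN conjunct2, THEN conjunct1, rule_format,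
        OF conjI[OF that(1) conjI[OF that(2,3)]] that(4)] .
  obtain C where C: "C \<subseteq> E" "independent C" "card C = dim E"
    by (rule basis_exists[of E])
  have disj: "C \<inter> Q = {}"
  proof (rule ccontr)
    assume "C \<inter> Q \<noteq> {}"
    then obtain v where "v \<in> C" "v \<in> Q"
      by blast
    then show False
      using indep[of "{v}" "\<lambda>_. 1" v] C(1) by auto
  qed
  have "independent (C \<union> Q)"
    unfolding independent_explicit_module
  proof (intro allI impI)
    fix T u v
    assume T: "finite T" "T \<subseteq> C \<union> Q" "(\<Sum>v\<in>T. scale (u v) v) = 0" "v \<in> T"
    have split: "(\<Sum>v\<in>T. scale (u v) v) = (\<Sum>v\<in>T \<inter> Q. scale (u v) v) + (\<Sum>v\<in>T - Q. scale (u v) v)"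
      using T(1) by (rule sum.Int_Diff)
    have TC: "T - Q \<subseteq> C"
      using T(2) by blast
    have "(\<Sum>v\<in>T - Q. scale (u v) v) \<in> E"
      using TC C(1) assms(2) by (intro subspace_sum subspace_scale) auto
    \<comment> \<open>A vanishing combination puts its \<open>Q\<close> part into \<open>E\<close>,
      which kills the coefficients on \<open>Q\<close>; independence of \<open>C\<close> then kills
      the others.\<close>
    moreover have "(\<Sum>v\<in>T \<inter> Q. scale (u v) v) = - (\<Sum>v\<in>T - Q. scale (u v) v)"
      using split T(3) by (simp add: eq_neg_iff_add_eq_0)
    ultimately have "(\<Sum>v\<in>T \<inter> Q. scale (u v) v) \<in> E"
      using assms(2) by (simp add: subspace_neg)
    then have Q0: "\<And>w. w \<in> T \<inter> Q \<Longrightarrow> u w = 0"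
      using indep[of "T \<inter> Q" u] T(1) by blast
    then have "(\<Sum>v\<in>T \<inter> Q. scale (u v) v) = 0"
      by (intro sum.neutral) auto
    then have "(\<Sum>v\<in>T - Q. scale (u v) v) = 0"
      using split T(3) by simp
    then have "\<And>w. w \<in> T - Q \<Longrightarrow> u w = 0"
      using independentD[OF C(2) _ TC] T(1) by blast
    with Q0 T(4) show "u v = 0"
      by blast
  qed
  moreover have CQ: "C \<union> Q \<subseteq> span U"
    using C(1) Q assms(3,4) by blast
  ultimately have fin: "finite C" "finite Q" and card: "dim (C \<union> Q) = card (C \<union> Q)"
    using independent_span_bound[OF assms(1), of "C \<union> Q"]
      dim_eq_card_independent[of "C \<union> Q"] by simp_all
  have "card C + card Q = dim (C \<union> Q)"
    unfolding card using fin disj by (rule card_Un_disjoint[symmetric])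
  also have "\<dots> \<le> dim U"
    using CQ assms(1) by (rule dim_mono_finite)
  finally have "card C + card Q \<le> dim U" .
  then show ?thesis
    using C(3) by (simp add: quotient_dim_def Q_def)
qed

end

lemma (in vector_space_pair) dim_image_le_finite:
  assumes "Vector_Spaces.linear s1 s2 f" "finite U"
  shows "vs2.dim (f ` U) \<le> vs1.dim U"
proof -
  interpret f: Vector_Spaces.linear s1 s2 f by fact
  obtain B where B: "B \<subseteq> U" "U \<subseteq> vs1.span B" "card B = vs1.dim U"
    by (rule vs1.basis_exists[of U])
  then have "finite B"
    using assms(2) finite_subset by blast
  have "vs2.dim (f ` U) \<le> card (f ` B)"
    using \<open>finite B\<close> f.spans_image[OF B(2)] by (intro vs2.dim_le_card) auto
  also have "\<dots> \<le> card B"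
    using \<open>finite B\<close> by (rule card_image_le)
  finally show ?thesis
    using B(3) by simp
qed

section \<open>Modules over the group ring\<close>

lemma sum_single_lookup:
  "(\<Sum>a\<in>Poly_Mapping.keys f. Poly_Mapping.single a (Poly_Mapping.lookup f a)) = f"
  by (rule poly_mapping_eqI) (auto simp: lookup_sum lookup_single when_def in_keys_iff)

text \<open>Replaces \<open>F\<close> by a finite set of group elements: take the union of the
  supports of finitely many generators, as the elements supported there form a subspace.\<close>

lemma fin_dim_subspace_keys:
  fixes F :: "('g::group_add, 'k::field) group_ring set"
  assumes "fin_dim_subspace (scalar_mult (*)) F"
  obtains S where "finite S" "\<And>f. f \<in> F \<Longrightarrow> Poly_Mapping.keys f \<subseteq> S"
proof -
  interpret vector_space "scalar_mult (*) :: 'k \<Rightarrow> ('g, 'k) group_ring \<Rightarrow> _"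
    by (rule vector_space_scalar_mult[OF left_module_group_ring])
  obtain B where B: "finite B" "span B = F"
    using assms by (auto simp: fin_dim_subspace_def)
  define S where "S = (\<Union>b\<in>B. Poly_Mapping.keys b)"
  have "subspace {f. Poly_Mapping.keys f \<subseteq> S}"
  proof (rule subspaceI)
    fix f h :: "('g, 'k) group_ring" and c :: 'k
    assume f: "f \<in> {f. Poly_Mapping.keys f \<subseteq> S}"
    show "f + h \<in> {f. Poly_Mapping.keys f \<subseteq> S}" if "h \<in> {f. Poly_Mapping.keys f \<subseteq> S}"
      using f that Poly_Mapping.keys_add[of f h] by blast
    have "Poly_Mapping.keys (Poly_Mapping.single 0 c * f) \<subseteq> Poly_Mapping.keys f"
      using keys_mult[of "Poly_Mapping.single 0 c" f] by (auto split: if_splits)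
    then show "scalar_mult (*) c f \<in> {f. Poly_Mapping.keys f \<subseteq> S}"
      using f by (auto simp: scalar_mult_def)
  qed simp
  then have "span B \<subseteq> {f. Poly_Mapping.keys f \<subseteq> S}"
    by (intro span_minimal) (auto simp: S_def)
  then show ?thesis
    using B by (intro that[of S]) (auto simp: S_def)
qed

lemma amenable_module_of_G_set:
  fixes act :: "'g::group_add \<Rightarrow> 'x \<Rightarrow> 'x"
    and smult :: "('g, 'k::field) group_ring \<Rightarrow> 'v::ab_group_add \<Rightarrow> 'v"
  assumes amenable: "amenable_G_set act Y"
    and module: "left_module smult"
    and equivariant: "\<And>g y. y \<in> Y \<Longrightarrow> v (act g y) = smult (Poly_Mapping.single g 1) (v y)"
    and nonzero: "\<And>y. y \<in> Y \<Longrightarrow> v y \<noteq> 0"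
  shows "amenable_module smult"
proof -
  interpret left_module smult by fact
  interpret vector_space "scalar_mult smult"
    by (rule vector_space_scalar_mult[OF module])
  interpret vector_space_pair "scalar_mult smult" "scalar_mult smult"
    by unfold_locales
  define T where "T g = smult (Poly_Mapping.single g 1)" for g
  have linear_T: "Vector_Spaces.linear (scalar_mult smult) (scalar_mult smult) (T g)" for g
    by unfold_locales
      (simp_all add: T_def scalar_mult_def smult_right_distrib mult_single flip: smult_assoc)
  have T_inverse: "T (- g) (T g w) = w" for g w
    by (simp add: T_def mult_single smult_one flip: smult_assoc)
  have T_act: "T g ` v ` B = v ` act g ` B" if "B \<subseteq> Y" for g B
    unfolding image_image T_def using that by (intro image_cong refl) (simp add: equivariant subsetD)
  \<comment> \<open>Neither \<open>T g\<close> nor its inverse \<open>T (- g)\<close> can raise the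
    dimension.\<close>
  have dim_T: "dim (T g ` U) = dim U" if "finite U" for g U
    using dim_image_le_finite[OF linear_T that, of g]
      dim_image_le_finite[OF linear_T finite_imageI[OF that], of "- g" "T g"]
    by (simp add: image_image T_inverse)
  interpret rank: submodular_rank Y "\<lambda>B. dim (v ` B)"
  proof
    show "dim (v ` {}) = 0"
      using dim_eq_card_independent[OF independent_empty] by simp
    show "dim (v ` {y}) = 1" if "y \<in> Y" for y
      using dim_eq_card_independent[of "{v y}"] nonzero[OF that] by (simp add: dependent_single)
    show "dim (v ` A) \<le> dim (v ` B)" if "A \<subseteq> B" "finite B" for A B
      using that by (intro dim_mono_finite) (auto intro: span_base)
    show "dim (v ` (A \<union> B)) + dim (v ` (A \<inter> B)) \<le> dim (v ` A) + dim (v ` B)"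
      if "finite A" "finite B" for A B
      using that by (simp add: image_Un dim_Un_Int_le image_mono)
  qed
  have "\<exists>E. fin_dim_subspace (scalar_mult smult) E \<and>
      real (quotient_dim (scalar_mult smult) {e + y | e y. e \<in> E \<and> y \<in> product_span smult F E} E)
        < \<epsilon> * real (dim E)"
    if F: "fin_dim_subspace (scalar_mult (*)) F" and eps: "\<epsilon> > 0"
    for F :: "('g, 'k) group_ring set" and \<epsilon> :: real
  proof -
    obtain S where S: "finite S" "\<And>f. f \<in> F \<Longrightarrow> Poly_Mapping.keys f \<subseteq> S"
      using fin_dim_subspace_keys[OF F] by blast
    have inv: "dim (v ` act g ` A) = dim (v ` A)" if "finite A" "A \<subseteq> Y" for g A
      using dim_T[of "v ` A" g] T_act[of A g] that by simp
    obtain B where B: "finite B" "B \<subseteq> Y" and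
      dim_B: "real (dim (v ` (B \<union> {act s b | s b. s \<in> S \<and> b \<in> B})))
        < (1 + \<epsilon>) * real (dim (v ` B))"
      by (rule rank.amenable_G_set_rank[OF amenable inv S(1) eps])
    define B' where "B' = B \<union> {act s b | s b. s \<in> S \<and> b \<in> B}"
    have "{act s b | s b. s \<in> S \<and> b \<in> B} = (\<Union>s\<in>S. act s ` B)"
      by auto
    then have "finite B'"
      using B S(1) by (simp add: B'_def)
    define E where "E = span (v ` B)"
    define W where "W = {e + y | e y. e \<in> E \<and> y \<in> product_span smult F E}"
    have E: "subspace E" "fin_dim_subspace (scalar_mult smult) E"
      using B(1) by (auto simp: E_def fin_dim_subspace_def)
    have T_E: "T g e \<in> span (v ` B')" if "g \<in> S" "e \<in> E" for g e
    proof -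
      interpret Tg: Vector_Spaces.linear "scalar_mult smult" "scalar_mult smult" "T g"
        by (rule linear_T)
      have "T g e \<in> span (T g ` v ` B)"
        using that(2) unfolding E_def Tg.span_image by blast
      also have "\<dots> \<subseteq> span (v ` B')"
        using that(1) T_act[OF B(2)] by (intro span_mono) (auto simp: B'_def)
      finally show ?thesis .
    qed
    \<comment> \<open>Expanding \<open>f\<close> over its support, which lies in \<open>S\<close>,
      writes \<open>smult f e\<close> as a linear combination of the vectors \<open>T g e\<close>
      with \<open>g\<close> in \<open>S\<close>.\<close>
    have "smult f e \<in> span (v ` B')" if "f \<in> F" "e \<in> E" for f e
    proof -
      have smult_sum: "smult (\<Sum>g\<in>K. h g) e = (\<Sum>g\<in>K. smult (h g) e)"
        if "finite K" for K and h :: "'g \<Rightarrow> ('g, 'k) group_ring"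
        using that
      proof induction
        case empty
        then show ?case using smult_left_distrib[of 0 0 e] by simp
      qed (simp add: smult_left_distrib)
      have "smult f e = (\<Sum>g\<in>Poly_Mapping.keys f.
          smult (Poly_Mapping.single g (Poly_Mapping.lookup f g)) e)"
        using smult_sum[OF finite_keys, of "\<lambda>g. Poly_Mapping.single g (Poly_Mapping.lookup f g)" f]
        by (simp only: sum_single_lookup)
      also have "\<dots> = (\<Sum>g\<in>Poly_Mapping.keys f.
          scalar_mult smult (Poly_Mapping.lookup f g) (T g e))"
        by (simp add: scalar_mult_def T_def mult_single flip: smult_assoc)
      also have "\<dots> \<in> span (v ` B')"
        using S(2)[OF that(1)] that(2) by (intro span_sum span_scale T_E) auto
      finally show ?thesis .
    qed
    then have "product_span smult F E \<subseteq> span (v ` B')"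
      unfolding product_span_def by (intro span_minimal) auto
    moreover have "E \<subseteq> span (v ` B')"
      unfolding E_def by (intro span_mono) (auto simp: B'_def)
    ultimately have "W \<subseteq> span (v ` B')"
      by (auto simp: W_def intro!: span_add)
    moreover have "E \<subseteq> W"
    proof
      fix e assume "e \<in> E"
      moreover have "0 \<in> product_span smult F E"
        by (simp add: product_span_def span_zero)
      ultimately show "e \<in> W"
        unfolding W_def by (metis (mono_tags, lifting) add.right_neutral mem_Collect_eq)
    qed
    ultimately have "quotient_dim (scalar_mult smult) W E + dim E \<le> dim (v ` B')"
      using \<open>finite B'\<close> E(1) by (intro quotient_dim_le) auto
    moreover have "real (dim (v ` B')) < (1 + \<epsilon>) * real (dim E)"
      using dim_B by (simp add: B'_def E_def)
    ultimately have "real (quotient_dim (scalar_mult smult) W E) < \<epsilon> * real (dim E)"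
      by (simp add: algebra_simps)
    with E(2) show ?thesis
      unfolding W_def by blast
  qed
  with module show ?thesis
    by (simp add: amenable_module_def)
qed

theorem theorem6:
  shows "(\<forall>(act :: 'g::group_add \<Rightarrow> 'x \<Rightarrow> 'x)
             (smult :: ('g, 'k::field) group_ring \<Rightarrow> 'v::ab_group_add \<Rightarrow> 'v)
             (q :: ('x \<Rightarrow>\<^sub>0 'k) \<Rightarrow> 'v).
           G_set act UNIV \<longrightarrow> left_module smult \<longrightarrow>
           left_module_hom (perm_smult act) smult q \<longrightarrow> surj q \<longrightarrow>
           (\<exists>x. q (Poly_Mapping.single x 1) \<noteq> 0 \<and> amenable_G_set act (orbit act x)) \<longrightarrow>
           amenable_module smult)
       \<and> (amenable_group TYPE('g) \<longrightarrow>
           (\<forall>smult :: ('g, 'k) group_ring \<Rightarrow> 'w::ab_group_add \<Rightarrow> 'w.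
             left_module smult \<longrightarrow> (\<exists>v::'w. v \<noteq> 0) \<longrightarrow> amenable_module smult))"
proof (intro conjI allI impI)
  fix act :: "'g \<Rightarrow> 'x \<Rightarrow> 'x" and smult :: "('g, 'k) group_ring \<Rightarrow> 'v \<Rightarrow> 'v"
    and q :: "('x \<Rightarrow>\<^sub>0 'k) \<Rightarrow> 'v"
  assume "G_set act UNIV" and module: "left_module smult"
    and "left_module_hom (perm_smult act) smult q"
    and "\<exists>x. q (Poly_Mapping.single x 1) \<noteq> 0 \<and> amenable_G_set act (orbit act x)"
  then obtain x where x: "q (Poly_Mapping.single x 1) \<noteq> 0" "amenable_G_set act (orbit act x)"
    by blast
  interpret G_set act UNIV by fact
  interpret left_module_hom "perm_smult act" smult q by fact
  have equivariant: "q (Poly_Mapping.single (act g y) 1) =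
      smult (Poly_Mapping.single g 1) (q (Poly_Mapping.single y 1))" for g y
    by (simp add: perm_smult_single flip: hom_smult)
  have smult_zero: "smult a 0 = 0" for a
    using target.smult_right_distrib[of a 0 0] by simp
  \<comment> \<open>Group elements act invertibly, so if \<open>q\<close> killed one point of the
    orbit it would also kill \<open>x\<close>.\<close>
  have "q (Poly_Mapping.single y 1) \<noteq> 0" if orbit: "y \<in> orbit act x" for y
  proof
    assume 0: "q (Poly_Mapping.single y 1) = 0"
    obtain g where "y = act g x"
      using orbit by (auto simp: orbit_def)
    then have "act (- g) y = x"
      using act_add[of x "- g" g] act_zero[of x] by simp
    then show False
      using equivariant[of "- g" y] 0 smult_zero x(1) by simp
  qed
  with x(2) module equivariant show "amenable_module smult"
    by (intro amenable_module_of_G_set[of act _ _ "\<lambda>y. q (Poly_Mapping.single y 1)"])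
next
  fix smult :: "('g, 'k) group_ring \<Rightarrow> 'w \<Rightarrow> 'w"
  assume amenable: "amenable_group TYPE('g)" and module: "left_module smult" and "\<exists>v::'w. v \<noteq> 0"
  then obtain w :: 'w where "w \<noteq> 0"
    by blast
  interpret left_module smult by fact
  have zero: "smult a 0 = 0" for a
    using smult_right_distrib[of a 0 0] by simp
  \<comment> \<open>The group itself serves as the G-set, mapped to the module by sending
    \<open>g\<close> to the translate of \<open>w\<close> by \<open>g\<close>; invertibility keeps
    all translates nonzero.\<close>
  have "smult (Poly_Mapping.single (- g) 1) (smult (Poly_Mapping.single g 1) w) = w" for g
    by (simp add: mult_single smult_one flip: smult_assoc)
  with \<open>w \<noteq> 0\<close> zero have "smult (Poly_Mapping.single g 1) w \<noteq> 0" for g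
    by metis
  then show "amenable_module smult"
    using amenable module
    by (intro amenable_module_of_G_set[of "(+)" UNIV _ "\<lambda>g. smult (Poly_Mapping.single g 1) w"])
      (simp_all add: amenable_group_def mult_single flip: smult_assoc)
qed

end
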